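(* For every $n$ and every $D\le n^{1/11}$, there exists an unweighted directed graph $G$ with $\Theta(n)$ vertices and diameter $D$ such that every subgraph $H$ of $G$ on the same vertex set with $\mathrm{diam}(H)<\frac{5}{3}\mathrm{diam}(G)-1$ contains $\Omega(n^{4/3}D^{1/3})$ edges.
   Context: $d_G(u,v)$ is the directed shortest-path distance and $\mathrm{diam}(G)=\max_{u,v}d_G(u,v)$. A subgraph of $G=(V,E)$ is a graph $(V,E')$ with $E'\subseteq E$. *)

theory Defs
  imports Complex_Main "HOL-Library.Extended_Nat"
begin

definition dist_G :: "('a \<times> 'a) set \<Rightarrow> 'a \<Rightarrow> 'a \<Rightarrow> enat" where
  "dist_G E u v = Inf {enat k | k. (u, v) \<in> E ^^ k}"

definition diam_G :: "'a set \<Rightarrow> ('a \<times> 'a) set \<Rightarrow> enat" where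
  "diam_G V E = Sup {dist_G E u v | u v. u \<in> V \<and> v \<in> V}"

definition digraph :: "'a set \<Rightarrow> ('a \<times> 'a) set \<Rightarrow> bool" where
  "digraph V E \<longleftrightarrow> finite V \<and> E \<subseteq> V \<times> V \<and> (\<forall>v. (v, v) \<notin> E)"

end

theory Submission
  imports Defs "HOL-Algebra.Algebraic_Closure_Type" "HOL-Library.Z2"
begin

text \<open>
  Let \<open>q\<close> be a power of two. For points \<open>x = (\<alpha>, \<beta>)\<close> and lines \<open>y = (\<kappa>, c)\<close>, given by
  \<open>\<beta> = \<kappa>\<alpha> + c\<close>, of the affine plane over the field with \<open>q\<close> elements, there is a start
  vertex \<open>s x\<close> and an end vertex \<open>t y\<close>. For an incident pair there are essentially two short
  routes from \<open>s x\<close> to \<open>t y\<close>: a path of length \<open>D\<close> through an edge \<open>e\<close> owned by the incident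
  pair, and a path through an edge \<open>f\<close>, owned by \<open>x\<close> and \<open>\<kappa>\<close>, leading into a path that is shared
  by all points with the same \<open>\<alpha>\<close> and all lines with the same \<open>\<kappa>\<close>. A potential function
  shows that without \<open>e\<close> and \<open>f\<close> the distance from \<open>s x\<close> to \<open>t y\<close> is at least \<open>5D/3 - 1\<close>.
  All these edges are distinct, so a subgraph of smaller diameter keeps at least one of them for each of
  the \<open>q\<^sup>3\<close> incident pairs. With \<open>n\<close> of order \<open>q\<^sup>2 D\<close> this is of order \<open>(n/D)\<^bsup>3/2\<^esup>\<close>, which
  dominates \<open>n\<^bsup>4/3\<^esup> D\<^bsup>1/3\<^esup>\<close> exactly when \<open>D \<le> n\<^bsup>1/11\<^esup>\<close>. The diameters 2 and 3
  are realized by blow-ups of directed cycles, from which no edge can be removed.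
\<close>

section \<open>Directed distances and diameters\<close>

lemma dist_G_le_iff: "dist_G E u v \<le> enat k \<longleftrightarrow> (\<exists>j\<le>k. (u, v) \<in> E ^^ j)"
proof
  assume le: "dist_G E u v \<le> enat k"
  show "\<exists>j\<le>k. (u, v) \<in> E ^^ j"
  proof (rule ccontr)
    assume "\<not> ?thesis"
    then have "enat (Suc k) \<le> dist_G E u v"
      unfolding dist_G_def by (intro Inf_greatest) (auto simp: not_le Suc_le_eq)
    then have "enat (Suc k) \<le> enat k" using le by (rule order.trans)
    then show False by simp
  qed
next
  assume "\<exists>j\<le>k. (u, v) \<in> E ^^ j"
  then obtain j where "j \<le> k" "(u, v) \<in> E ^^ j" by blast
  then have "dist_G E u v \<le> enat j" unfolding dist_G_def by (intro Inf_lower) auto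
  with \<open>j \<le> k\<close> show "dist_G E u v \<le> enat k" by (meson enat_ord_simps(1) order.trans)
qed

lemma diam_G_le_iff:
  "diam_G V E \<le> enat k \<longleftrightarrow> (\<forall>u\<in>V. \<forall>v\<in>V. \<exists>j\<le>k. (u, v) \<in> E ^^ j)"
  unfolding diam_G_def Sup_le_iff by (auto simp flip: dist_G_le_iff)

lemma diam_G_eqI:
  assumes "\<And>u v. u \<in> V \<Longrightarrow> v \<in> V \<Longrightarrow> \<exists>j\<le>D. (u, v) \<in> E ^^ j"
    and "u \<in> V" "v \<in> V" "\<And>j. (u, v) \<in> E ^^ j \<Longrightarrow> D \<le> j"
  shows "diam_G V E = enat D"
proof (rule antisym)
  show "diam_G V E \<le> enat D" using assms(1) by (simp add: diam_G_le_iff)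
  have "enat D \<le> dist_G E u v" unfolding dist_G_def using assms(4) by (intro Inf_greatest) auto
  also have "\<dots> \<le> diam_G V E" unfolding diam_G_def using assms(2,3) by (intro Sup_upper) auto
  finally show "enat D \<le> diam_G V E" .
qed

text \<open>A walk climbs at most one unit per edge. Exhibiting a suitable \<open>\<phi>\<close>
  thus certifies a lower bound on walk lengths without any analysis of the walks.\<close>

lemma potential_relpow:
  fixes \<phi> :: "'a \<Rightarrow> nat"
  assumes "(u, v) \<in> E ^^ j" "\<And>x y. (x, y) \<in> E \<Longrightarrow> \<phi> y \<le> \<phi> x + 1"
  shows "\<phi> v \<le> \<phi> u + j"
  using assms(1)
proof (induction j arbitrary: v)
  case (Suc j)
  then obtain w where "(u, w) \<in> E ^^ j" "(w, v) \<in> E" by auto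
  then show ?case using Suc.IH[of w] assms(2)[of w v] by simp
qed simp

lemma relpow_subset:
  fixes E E' :: "('a \<times> 'a) set"
  assumes "E \<subseteq> E'"
  shows "E ^^ j \<subseteq> E' ^^ j"
  using assms by (induction j) (auto intro: relcompI)

text \<open>The condition \<open>3 * k + 3 < 5 * D\<close> is k < 5D/3 - 1 cleared of fractions.
  Subgraphs of infinite diameter drop out because \<open>k\<close> is a natural number.\<close>

definition hard_graph :: "'a set \<Rightarrow> ('a \<times> 'a) set \<Rightarrow> nat \<Rightarrow> nat \<Rightarrow> bool" where
  "hard_graph V E D L \<longleftrightarrow> digraph V E \<and> diam_G V E = enat D \<and>
     (\<forall>E'\<subseteq>E. \<forall>k. diam_G V E' = enat k \<longrightarrow> 3 * k + 3 < 5 * D \<longrightarrow> L \<le> card E')"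

section \<open>Relabelling of vertices by natural numbers\<close>

lemma relpow_map_prod_iff:
  assumes "inj f"
  shows "(f u, w) \<in> (map_prod f f ` E) ^^ j \<longleftrightarrow> (\<exists>v. w = f v \<and> (u, v) \<in> E ^^ j)"
proof (induction j arbitrary: w)
  case 0
  then show ?case by auto
next
  case (Suc j)
  show ?case
  proof
    assume "(f u, w) \<in> (map_prod f f ` E) ^^ Suc j"
    then obtain z where "(f u, z) \<in> (map_prod f f ` E) ^^ j" "(z, w) \<in> map_prod f f ` E" by auto
    then show "\<exists>v. w = f v \<and> (u, v) \<in> E ^^ Suc j"
      using Suc.IH[of z] injD[OF assms] by (auto simp: relcomp_unfold)
  next
    assume "\<exists>v. w = f v \<and> (u, v) \<in> E ^^ Suc j"
    then obtain v z where "w = f v" "(u, z) \<in> E ^^ j" "(z, v) \<in> E" by auto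
    then show "(f u, w) \<in> (map_prod f f ` E) ^^ Suc j"
      using Suc.IH[of "f z"] by (auto simp: relcomp_unfold)
  qed
qed

lemma diam_G_map_prod:
  assumes "inj f"
  shows "diam_G (f ` V) (map_prod f f ` E) = diam_G V E"
proof -
  have "dist_G (map_prod f f ` E) (f u) (f v) = dist_G E u v" for u v
    unfolding dist_G_def relpow_map_prod_iff[OF assms] using injD[OF assms] by metis
  then have "{dist_G (map_prod f f ` E) u v |u v. u \<in> f ` V \<and> v \<in> f ` V} =
      {dist_G E u v |u v. u \<in> V \<and> v \<in> V}" by (simp add: setcompr_eq_image image_def) (metis (no_types, lifting))
  then show ?thesis unfolding diam_G_def by simp
qed

lemma hard_graph_map_prod:
  assumes "inj f" "hard_graph V E D L"
  shows "hard_graph (f ` V) (map_prod f f ` E) D L"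
  unfolding hard_graph_def
proof (intro conjI allI impI)
  show "digraph (f ` V) (map_prod f f ` E)"
    using assms injD[OF assms(1)] unfolding hard_graph_def digraph_def by (auto simp: map_prod_def)
  show "diam_G (f ` V) (map_prod f f ` E) = enat D"
    using assms by (simp add: diam_G_map_prod hard_graph_def)
  fix E' k assume "E' \<subseteq> map_prod f f ` E" and d: "diam_G (f ` V) E' = enat k" "3 * k + 3 < 5 * D"
  then obtain E'' where E'': "E'' \<subseteq> E" "E' = map_prod f f ` E''" by (meson subset_imageE)
  have "inj (map_prod f f)" using assms(1) by (simp add: prod.inj_map)
  then have "card E' = card E''" unfolding E''(2) by (meson card_image inj_on_subset subset_UNIV)
  then show "L \<le> card E'"
    using assms d E'' by (auto simp: diam_G_map_prod hard_graph_def)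
qed

lemma hard_graph_nat:
  fixes V :: "'a :: countable set"
  assumes "hard_graph V E D L"
  shows "\<exists>(V' :: nat set) E'. hard_graph V' E' D L \<and> card V' = card V"
  using hard_graph_map_prod[OF _ assms, of to_nat] card_image[of to_nat V]
  by (metis inj_on_subset inj_to_nat subset_UNIV)

section \<open>The affine plane over a field of characteristic two\<close>

text \<open>Only incidence facts on labels below \<open>q\<close> are kept, so the graph
  construction never touches field arithmetic. All lines are non-vertical: distinct points of one
  column \<open>\<alpha>\<close> have no joining line.\<close>

locale affine_net =
  fixes q :: nat and inc :: "nat \<Rightarrow> nat \<Rightarrow> nat \<Rightarrow> nat \<Rightarrow> bool"
  assumes inc_less: "inc \<alpha> \<beta> \<kappa> c \<Longrightarrow> \<alpha> < q \<and> \<beta> < q \<and> \<kappa> < q \<and> c < q"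
    and line_ex: "\<lbrakk>\<alpha> < q; \<beta> < q; \<kappa> < q\<rbrakk> \<Longrightarrow> \<exists>c. inc \<alpha> \<beta> \<kappa> c"
    and line_unique: "\<lbrakk>inc \<alpha> \<beta> \<kappa> c; inc \<alpha> \<beta> \<kappa> c'\<rbrakk> \<Longrightarrow> c = c'"
    and point_ex: "\<lbrakk>\<alpha> < q; \<kappa> < q; c < q\<rbrakk> \<Longrightarrow> \<exists>\<beta>. inc \<alpha> \<beta> \<kappa> c"
    and point_unique: "\<lbrakk>inc \<alpha> \<beta> \<kappa> c; inc \<alpha> \<beta>' \<kappa> c\<rbrakk> \<Longrightarrow> \<beta> = \<beta>'"
    and join_ex: "\<lbrakk>\<alpha> < q; \<beta> < q; \<alpha>' < q; \<beta>' < q; \<alpha> \<noteq> \<alpha>'\<rbrakk> \<Longrightarrow> \<exists>\<kappa> c. inc \<alpha> \<beta> \<kappa> c \<and> inc \<alpha>' \<beta>' \<kappa> c"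
    and meet_ex: "\<lbrakk>\<kappa> < q; c < q; \<kappa>' < q; c' < q; \<kappa> \<noteq> \<kappa>'\<rbrakk> \<Longrightarrow> \<exists>\<alpha> \<beta>. inc \<alpha> \<beta> \<kappa> c \<and> inc \<alpha> \<beta> \<kappa>' c'"
    and join_unique: "\<lbrakk>inc \<alpha> \<beta> \<kappa> c; inc \<alpha>' \<beta>' \<kappa> c; inc \<alpha> \<beta> \<kappa>' c'; inc \<alpha>' \<beta>' \<kappa>' c'\<rbrakk>
      \<Longrightarrow> \<alpha> = \<alpha>' \<and> \<beta> = \<beta>' \<or> \<kappa> = \<kappa>' \<and> c = c'"

lemma affine_netI:
  fixes K :: "'f :: field set"
  assumes fin: "finite K" "K \<noteq> {}"
    and diff: "\<And>x y. x \<in> K \<Longrightarrow> y \<in> K \<Longrightarrow> x - y \<in> K"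
    and mult: "\<And>x y. x \<in> K \<Longrightarrow> y \<in> K \<Longrightarrow> x * y \<in> K"
    and divide: "\<And>x y. x \<in> K \<Longrightarrow> y \<in> K \<Longrightarrow> x / y \<in> K"
  shows "\<exists>inc. affine_net (card K) inc"
proof -
  let ?q = "card K"
  obtain f where f: "bij_betw f {..<?q} K"
    using ex_bij_betw_nat_finite[OF fin(1)] by (auto simp: atLeast0LessThan)
  have f_K: "f i \<in> K" if "i < ?q" for i using f that by (auto simp: bij_betw_def)
  have f_inj: "f i = f j \<longleftrightarrow> i = j" if "i < ?q" "j < ?q" for i j
    using f that by (auto simp: bij_betw_def inj_on_def)
  have f_surj: "\<exists>i<?q. f i = x" if "x \<in> K" for x
    using f that by (metis bij_betw_def image_iff lessThan_iff)
  have add: "x + y \<in> K" if "x \<in> K" "y \<in> K" for x y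
  proof -
    \<comment> \<open>Closure under subtraction alone yields 0 and negatives, hence sums.\<close>
    have "x - ((y - y) - y) \<in> K" using that by (intro diff)
    then show ?thesis by simp
  qed
  define inc where "inc \<alpha> \<beta> \<kappa> c \<longleftrightarrow> \<alpha> < ?q \<and> \<beta> < ?q \<and> \<kappa> < ?q \<and> c < ?q \<and> f \<beta> = f \<kappa> * f \<alpha> + f c"
    for \<alpha> \<beta> \<kappa> c
  have "affine_net ?q inc"
  proof
    show "\<alpha> < ?q \<and> \<beta> < ?q \<and> \<kappa> < ?q \<and> c < ?q" if "inc \<alpha> \<beta> \<kappa> c" for \<alpha> \<beta> \<kappa> c
      using that by (simp add: inc_def)
  next
    fix \<alpha> \<beta> \<kappa> assume *: "\<alpha> < ?q" "\<beta> < ?q" "\<kappa> < ?q"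
    then obtain c where "c < ?q" "f c = f \<beta> - f \<kappa> * f \<alpha>"
      using f_surj[OF diff[OF f_K[OF *(2)] mult[OF f_K[OF *(3)] f_K[OF *(1)]]]] by blast
    then show "\<exists>c. inc \<alpha> \<beta> \<kappa> c" using * by (auto simp: inc_def)
  next
    fix \<alpha> \<beta> \<kappa> c c' assume "inc \<alpha> \<beta> \<kappa> c" "inc \<alpha> \<beta> \<kappa> c'"
    then have "f c = f c'" "c < ?q" "c' < ?q" by (simp_all add: inc_def)
    then show "c = c'" using f_inj by blast
  next
    fix \<alpha> \<kappa> c assume *: "\<alpha> < ?q" "\<kappa> < ?q" "c < ?q"
    then obtain \<beta> where "\<beta> < ?q" "f \<beta> = f \<kappa> * f \<alpha> + f c"
      using f_surj[OF add[OF mult[OF f_K[OF *(2)] f_K[OF *(1)]] f_K[OF *(3)]]] by blast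
    then show "\<exists>\<beta>. inc \<alpha> \<beta> \<kappa> c" using * by (auto simp: inc_def)
  next
    fix \<alpha> \<beta> \<kappa> c \<beta>' assume "inc \<alpha> \<beta> \<kappa> c" "inc \<alpha> \<beta>' \<kappa> c"
    then have "f \<beta> = f \<beta>'" "\<beta> < ?q" "\<beta>' < ?q" by (simp_all add: inc_def)
    then show "\<beta> = \<beta>'" using f_inj by blast
  next
    fix \<alpha> \<beta> \<alpha>' \<beta>' assume *: "\<alpha> < ?q" "\<beta> < ?q" "\<alpha>' < ?q" "\<beta>' < ?q" "\<alpha> \<noteq> \<alpha>'"
    then obtain \<kappa> where \<kappa>: "\<kappa> < ?q" "f \<kappa> = (f \<beta> - f \<beta>') / (f \<alpha> - f \<alpha>')"
      using f_surj[OF divide[OF diff[OF f_K[OF *(2)] f_K[OF *(4)]] diff[OF f_K[OF *(1)] f_K[OF *(3)]]]] by blast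
    moreover obtain c where "c < ?q" "f c = f \<beta> - f \<kappa> * f \<alpha>"
      using f_surj[OF diff[OF f_K[OF *(2)] mult[OF f_K[OF \<kappa>(1)] f_K[OF *(1)]]]] by blast
    moreover have "f \<alpha> - f \<alpha>' \<noteq> 0" using * f_inj by simp
    then have "f \<kappa> * (f \<alpha> - f \<alpha>') = f \<beta> - f \<beta>'" using \<kappa>(2) by simp
    then have "f \<beta>' = f \<beta> - f \<kappa> * (f \<alpha> - f \<alpha>')" by simp
    then have "f \<beta>' = f \<kappa> * f \<alpha>' + (f \<beta> - f \<kappa> * f \<alpha>)"
      by (simp add: right_diff_distrib)
    ultimately show "\<exists>\<kappa> c. inc \<alpha> \<beta> \<kappa> c \<and> inc \<alpha>' \<beta>' \<kappa> c"
      using * by (intro exI[of _ \<kappa>] exI[of _ c]) (simp add: inc_def)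
  next
    fix \<kappa> c \<kappa>' c' assume *: "\<kappa> < ?q" "c < ?q" "\<kappa>' < ?q" "c' < ?q" "\<kappa> \<noteq> \<kappa>'"
    then obtain \<alpha> where \<alpha>: "\<alpha> < ?q" "f \<alpha> = (f c' - f c) / (f \<kappa> - f \<kappa>')"
      using f_surj[OF divide[OF diff[OF f_K[OF *(4)] f_K[OF *(2)]] diff[OF f_K[OF *(1)] f_K[OF *(3)]]]] by blast
    moreover obtain \<beta> where "\<beta> < ?q" "f \<beta> = f \<kappa> * f \<alpha> + f c"
      using f_surj[OF add[OF mult[OF f_K[OF *(1)] f_K[OF \<alpha>(1)]] f_K[OF *(2)]]] by blast
    moreover have "f \<kappa> - f \<kappa>' \<noteq> 0" using * f_inj by simp
    then have "(f \<kappa> - f \<kappa>') * f \<alpha> = f c' - f c" using \<alpha>(2) by simp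
    then have "f \<kappa> * f \<alpha> + f c = f \<kappa>' * f \<alpha> + f c'"
      by (simp add: left_diff_distrib diff_eq_eq)
    ultimately show "\<exists>\<alpha> \<beta>. inc \<alpha> \<beta> \<kappa> c \<and> inc \<alpha> \<beta> \<kappa>' c'"
      using * by (intro exI[of _ \<alpha>] exI[of _ \<beta>]) (simp add: inc_def)
  next
    fix \<alpha> \<beta> \<kappa> c \<alpha>' \<beta>' \<kappa>' c'
    assume *: "inc \<alpha> \<beta> \<kappa> c" "inc \<alpha>' \<beta>' \<kappa> c" "inc \<alpha> \<beta> \<kappa>' c'" "inc \<alpha>' \<beta>' \<kappa>' c'"
    then have eqs: "f \<kappa> * f \<alpha> = f \<beta> - f c" "f \<kappa> * f \<alpha>' = f \<beta>' - f c"
        "f \<kappa>' * f \<alpha> = f \<beta> - f c'" "f \<kappa>' * f \<alpha>' = f \<beta>' - f c'"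
      by (simp_all add: inc_def eq_diff_eq)
    \<comment> \<open>Two lines through the same two points make this product vanish, and a field
      has no zero divisors.\<close>
    have "(f \<kappa> - f \<kappa>') * (f \<alpha> - f \<alpha>') =
        f \<kappa> * f \<alpha> - f \<kappa> * f \<alpha>' - f \<kappa>' * f \<alpha> + f \<kappa>' * f \<alpha>'" by (simp add: algebra_simps)
    also have "\<dots> = 0" unfolding eqs by simp
    finally have "f \<kappa> = f \<kappa>' \<or> f \<alpha> = f \<alpha>'" by simp
    then have "\<kappa> = \<kappa>' \<or> \<alpha> = \<alpha>'" using * f_inj unfolding inc_def by blast
    then show "\<alpha> = \<alpha>' \<and> \<beta> = \<beta>' \<or> \<kappa> = \<kappa>' \<and> c = c'"
    proof
      assume "\<kappa> = \<kappa>'"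
      then have "f c = f c'" "c < ?q" "c' < ?q" using * by (simp_all add: inc_def)
      then have "c = c'" using f_inj by blast
      with \<open>\<kappa> = \<kappa>'\<close> show ?thesis by simp
    next
      assume "\<alpha> = \<alpha>'"
      then have "f \<beta> = f \<beta>'" "\<beta> < ?q" "\<beta>' < ?q" using * by (simp_all add: inc_def)
      then have "\<beta> = \<beta>'" using f_inj by blast
      with \<open>\<alpha> = \<alpha>'\<close> show ?thesis by simp
    qed
  qed
  then show ?thesis by blast
qed

text \<open>Over an algebraically closed field \<open>p\<close> splits into linear factors. A
  repeated factor would make the derivative vanish at its root, so the roots are distinct.\<close>

lemma card_roots_separable:
  fixes p :: "'a :: alg_closed_field poly"
  assumes "p \<noteq> 0" "\<And>x. poly p x = 0 \<Longrightarrow> poly (pderiv p) x \<noteq> 0"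
  shows "card {x. poly p x = 0} = degree p"
proof -
  obtain A l where A: "size A = degree p" "p = smult l (\<Prod>x\<in>#A. [:-x, 1:])"
    using alg_closed_imp_factorization[OF assms(1)] by blast
  have "count A x = 1" if "x \<in># A" for x
  proof (rule ccontr)
    assume "count A x \<noteq> 1"
    with that have "x \<in># A - {#x#}"
      by (metis One_nat_def Suc_lessI count_greater_zero_iff count_single in_diff_count)
    then obtain B where "A - {#x#} = add_mset x B" by (rule multi_member_split[THEN exE])
    then have "A = add_mset x (add_mset x B)" using insert_DiffM[OF that] by simp
    then obtain r where r: "p = [:-x, 1:] * ([:-x, 1:] * r)"
      by (simp add: A(2) that[of "smult l (\<Prod>x\<in>#B. [:-x, 1:])"])
    have "poly p x = 0" "poly (pderiv p) x = 0" by (simp_all only: r pderiv_mult) (simp_all add: pderiv_pCons)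
    with assms(2) show False by blast
  qed
  then have "size A = card (set_mset A)" unfolding size_multiset_overloaded_eq by simp
  moreover have "set_mset A = {x. poly p x = 0}"
  proof -
    have "poly p x = l * (\<Prod>y\<in>#A. x - y)" for x
      by (simp add: A(2) poly_prod_mset image_mset.compositionality o_def)
    moreover have "l \<noteq> 0" using A(2) assms(1) by auto
    ultimately show ?thesis by (auto simp: prod_mset_zero_iff)
  qed
  ultimately show ?thesis using A(1) by simp
qed

text \<open>The field consists of the roots of X^q - X in the algebraic closure of the two-element
  field, where q = 2^h. The derivative is -1, so there are exactly q roots; they are closed under
  subtraction because taking q-th powers is additive in characteristic two.\<close>

lemma affine_net_power_of_two: "\<exists>inc. affine_net (2 ^ h) inc"
proof (cases "h = 0")
  case True
  \<comment> \<open>For \<open>h = 0\<close> the polynomial degenerates to zero. The set containing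
    only 0 is closed under all operations, since division by zero gives zero.\<close>
  then show ?thesis using affine_netI[of "{0 :: rat}"] by simp
next
  case False
  let ?q = "2 ^ h :: nat"
  define K where "K = {x :: bit alg_closure. x ^ ?q = x}"
  have two: "(2 :: bit alg_closure) = 0"
    by (metis to_ac_0 to_ac_numeral bit_numeral_even(1))
  have neg: "- x = x" for x :: "bit alg_closure"
    using two by (metis add_eq_0_iff mult_2 mult_zero_left)
  have frobenius: "(x + y) ^ ?q = x ^ ?q + y ^ ?q" for x y :: "bit alg_closure"
  proof (induction h)
    case (Suc h)
    have "(x + y) ^ 2 ^ Suc h = ((x + y) ^ 2 ^ h)\<^sup>2" by (simp flip: power_mult add: mult.commute)
    also have "\<dots> = (x ^ 2 ^ h)\<^sup>2 + (y ^ 2 ^ h)\<^sup>2" using two by (simp add: Suc power2_sum)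
    finally show ?case by (simp flip: power_mult add: mult.commute)
  qed simp
  let ?p = "monom 1 ?q - [:0, 1:] :: bit alg_closure poly"
  have q: "1 < ?q" using False by (intro one_less_power) auto
  then have deg: "degree ?p = ?q"
    using degree_add_eq_left[of "- [:0, 1:]" "monom (1 :: bit alg_closure) ?q"]
    by (simp add: degree_monom_eq del: minus_pCons)
  have "pderiv ?p = - 1"
    using two False by (simp add: pderiv_diff pderiv_monom pderiv_pCons power_0_left one_pCons)
  then have "card {x. poly ?p x = 0} = ?q"
    using q deg by (subst card_roots_separable) (auto simp: deg simp del: monom_eq_1)
  also have "{x. poly ?p x = 0} = K" by (auto simp: K_def poly_monom)
  finally have "card K = ?q" .
  moreover have "\<exists>inc. affine_net (card K) inc"
  proof (rule affine_netI)
    show "finite K" using \<open>card K = ?q\<close> card.infinite[of K] by fastforce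
    show "K \<noteq> {}" using \<open>card K = ?q\<close> by auto
    show "x - y \<in> K" if "x \<in> K" "y \<in> K" for x y
    proof -
      have "x - y = x + y" by (subst diff_conv_add_uminus) (simp only: neg)
      then show ?thesis using that frobenius[of x y] unfolding \<open>x - y = x + y\<close> K_def by simp
    qed
  qed (auto simp: K_def power_mult_distrib power_divide)
  ultimately show ?thesis by simp
qed

section \<open>Diameter at most three\<close>

text \<open>The directed \<open>D\<close>-cycle with every vertex blown up into \<open>m\<close>
  copies.\<close>

definition cyc_edges :: "nat \<Rightarrow> nat \<Rightarrow> ((nat \<times> nat) \<times> (nat \<times> nat)) set" where
  "cyc_edges D m = {((r, i), ((r + 1) mod D, j)) | r i j. r < D \<and> i < m \<and> j < m}"

lemma cyc_edges_walk:
  assumes "((r, i), (r', j)) \<in> cyc_edges D m ^^ l" "r < D"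
  shows "r' = (r + l) mod D"
  using assms(1)
proof (induction l arbitrary: r' j)
  case 0
  then show ?case using assms(2) by simp
next
  case (Suc l)
  then obtain z where z: "((r, i), z) \<in> cyc_edges D m ^^ l" "(z, (r', j)) \<in> cyc_edges D m" by auto
  then have "fst z = (r + l) mod D" using Suc.IH[of "fst z" "snd z"] by simp
  then show ?case using z(2) by (auto simp: cyc_edges_def mod_simps)
qed

lemma cyc_edges_walk_ex:
  assumes "r < D" "i < m" "j < m"
  shows "((r, i), ((r + Suc l) mod D, j)) \<in> cyc_edges D m ^^ Suc l"
  using assms(3)
proof (induction l arbitrary: j)
  case 0
  then show ?case using assms by (auto simp: cyc_edges_def)
next
  case (Suc l)
  have "(((r + Suc l) mod D, j), ((r + Suc (Suc l)) mod D, j)) \<in> cyc_edges D m" using assms Suc.prems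
    by (auto simp: cyc_edges_def mod_simps intro!: exI[of _ "(r + Suc l) mod D"])
  with Suc.IH[OF Suc.prems] show ?case by auto
qed

lemma hard_graph_cyc_edges:
  assumes D: "2 \<le> D" "D \<le> 3" and m: "2 \<le> m"
  shows "hard_graph ({..<D} \<times> {..<m}) (cyc_edges D m) D (D * m ^ 2)"
proof -
  let ?V = "{..<D} \<times> {..<m}" and ?E = "cyc_edges D m"
  have dig: "digraph ?V ?E"
    unfolding digraph_def
  proof (intro conjI allI)
    show "?E \<subseteq> ?V \<times> ?V" using D by (auto simp: cyc_edges_def)
    show "(v, v) \<notin> ?E" for v
    proof
      assume "(v, v) \<in> ?E"
      then obtain r where "r < D" "(r + 1) mod D = r" by (auto simp: cyc_edges_def)
      then show False using D by (cases "r + 1 = D") auto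
    qed
  qed simp
  have diam: "diam_G ?V ?E = enat D"
  proof (rule diam_G_eqI)
    fix u v assume "u \<in> ?V" "v \<in> ?V"
    then obtain r i r' j where uv: "u = (r, i)" "v = (r', j)" "r < D" "r' < D" "i < m" "j < m" by auto
    define l where "l = (if r < r' then r' - r - 1 else D + r' - r - 1)"
    have "Suc l \<le> D" "(r + Suc l) mod D = r'" using uv by (auto simp: l_def mod_if)
    then show "\<exists>l\<le>D. (u, v) \<in> ?E ^^ l" using cyc_edges_walk_ex[of r D i m j l] uv by metis
  next
    show "(0, 0) \<in> ?V" "(0, 1) \<in> ?V" using D m by auto
    fix l assume l: "((0, 0), (0, 1)) \<in> ?E ^^ l"
    then have "l mod D = 0" using cyc_edges_walk[OF l] D by simp
    moreover have "l \<noteq> 0" using l by (intro notI) simp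
    ultimately show "D \<le> l" by (simp add: dvd_imp_le mod_0_imp_dvd)
  qed
  have "D * m ^ 2 \<le> card E'" if E': "E' \<subseteq> ?E" "diam_G ?V E' = enat k" "3 * k + 3 < 5 * D" for E' k
  proof -
    have "?E \<subseteq> E'"
    proof
      fix e assume e: "e \<in> ?E"
      then obtain r i j where rij: "e = ((r, i), ((r + 1) mod D, j))" "r < D" "i < m" "j < m"
        by (auto simp: cyc_edges_def)
      then have "(r, i) \<in> ?V" "((r + 1) mod D, j) \<in> ?V" using D by auto
      moreover have "diam_G ?V E' \<le> enat k" using E'(2) by simp
      ultimately obtain l where l: "l \<le> k" "e \<in> E' ^^ l" unfolding diam_G_le_iff rij(1) by blast
      have "(r + 1) mod D = (r + l) mod D"
        using cyc_edges_walk[OF subsetD[OF relpow_subset[OF E'(1)] l(2)[unfolded rij(1)]] rij(2)] .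
      moreover have "l \<le> D" using l(1) E'(3) D by linarith
      moreover have "D = 2 \<or> D = 3" using D by linarith
      ultimately have "l = 1" using rij(2) by (elim disjE) (simp_all only:, presburger+)
      with l(2) show "e \<in> E'" by simp
    qed
    then have "E' = ?E" using E'(1) by simp
    moreover have "card ?E = card ({..<D} \<times> {..<m} \<times> {..<m})"
    proof -
      have "?E = (\<lambda>(r, i, j). ((r, i), ((r + 1) mod D, j))) ` ({..<D} \<times> {..<m} \<times> {..<m})"
        by (auto simp: cyc_edges_def image_iff)
      moreover have "inj_on (\<lambda>(r, i, j). ((r, i), ((r + 1) mod D, j))) ({..<D} \<times> {..<m} \<times> {..<m})"
        by (auto simp: inj_on_def)
      ultimately show ?thesis by (simp add: card_image)
    qed
    ultimately show ?thesis by (simp add: power2_eq_square)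
  qed
  with dig diam show ?thesis by (auto simp: hard_graph_def)
qed

text \<open>For D = 1 the bound on \<open>k\<close> forces k = 0, impossible with two vertices. The
  edge bound is vacuous, so \<open>L\<close> is arbitrary.\<close>

lemma hard_graph_complete:
  assumes "2 \<le> n"
  shows "hard_graph {..<n :: nat} {(u, v). u < n \<and> v < n \<and> u \<noteq> v} 1 L"
proof -
  let ?E = "{(u, v). u < n \<and> v < n \<and> u \<noteq> v}"
  have "diam_G {..<n} ?E = enat 1"
  proof (rule diam_G_eqI)
    fix u v assume "u \<in> {..<n}" "v \<in> {..<n}"
    then show "\<exists>j\<le>1. (u, v) \<in> ?E ^^ j"
      by (cases "u = v") (auto intro: exI[of _ 0] exI[of _ 1])
  next
    show "0 \<in> {..<n}" "1 \<in> {..<n}" using assms by auto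
    show "1 \<le> j" if "(0, 1) \<in> ?E ^^ j" for j using that by (cases j) auto
  qed
  moreover have "diam_G {..<n} E' \<noteq> enat k" if "3 * k + 3 < 5 * 1" for E' k
  proof
    assume "diam_G {..<n} E' = enat k"
    moreover have "k = 0" using that by simp
    ultimately have "diam_G {..<n} E' \<le> enat 0" by simp
    then have "\<forall>u\<in>{..<n}. \<forall>v\<in>{..<n}. \<exists>j\<le>0. (u, v) \<in> E' ^^ j" by (simp only: diam_G_le_iff)
    from this[rule_format, of 0 1] show False using assms by simp
  qed
  ultimately show ?thesis by (auto simp: hard_graph_def digraph_def)
qed

section \<open>The graph on points and lines\<close>

text \<open>
  For a point \<open>(\<alpha>, \<beta>)\<close>, the path \<open>T \<alpha> \<beta> a, \<dots>, T \<alpha> \<beta> 0\<close> leads from the start vertex to the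
  edges \<open>e\<close>, and the path \<open>Z \<alpha> \<beta> 0, \<dots>, Z \<alpha> \<beta> (b - 1)\<close> to the edges \<open>f\<close> into the shared path
  \<open>Q \<alpha> \<kappa>\<close>. The path \<open>Y \<kappa> c\<close> leads to the end vertex \<open>Y \<kappa> c g\<close> of a line, and the
  descending path \<open>C \<alpha>\<close> leads back to the vertices \<open>T \<alpha> \<beta> 0\<close> for all \<open>\<beta>\<close>.
\<close>

datatype vert = T nat nat nat | Z nat nat nat | C nat nat | Q nat nat nat | Y nat nat nat

instance vert :: countable
  by countable_datatype

locale spanner_net = affine_net q inc for q inc +
  fixes a b g :: nat
  assumes q_pos: "0 < q"
    and ab: "1 \<le> b" "b \<le> a" "a \<le> b + 1" and g: "a + b \<le> g + 1" "2 * b \<le> g"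
begin

text \<open>For \<open>a = 1\<close> the return path \<open>C \<alpha>\<close> has no vertices, so
  its targets take over as entry points.\<close>

definition entry :: "nat \<Rightarrow> vert \<Rightarrow> bool" where
  "entry \<alpha> v \<longleftrightarrow> (if a = 1 then \<exists>\<beta><q. v = T \<alpha> \<beta> 0 else v = C \<alpha> (a - 1))"

text \<open>The route through \<open>T_Y\<close> has a + 1 + g edges. The route through
  \<open>Z_Q\<close> spends one edge to enter \<open>Z\<close>, b to reach \<open>Q\<close>, a to
  reach \<open>Y \<kappa> c b\<close> and g - b to the end, again a + 1 + g. The edges on neither
  route are shortcuts and returns that keep all other pairs within this distance.\<close>

inductive adj :: "vert \<Rightarrow> vert \<Rightarrow> bool" where
  T_down: "\<lbrakk>\<alpha> < q; \<beta> < q; i < a\<rbrakk> \<Longrightarrow> adj (T \<alpha> \<beta> (Suc i)) (T \<alpha> \<beta> i)"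
| T_up: "\<lbrakk>\<alpha> < q; \<beta> < q; 0 < i; i \<le> a\<rbrakk> \<Longrightarrow> adj (T \<alpha> \<beta> 0) (T \<alpha> \<beta> i)"
| T_Z: "\<lbrakk>\<alpha> < q; \<beta> < q; i \<le> a\<rbrakk> \<Longrightarrow> adj (T \<alpha> \<beta> i) (Z \<alpha> \<beta> 0)"
| Z_Z: "\<lbrakk>\<alpha> < q; \<beta> < q; Suc n < b\<rbrakk> \<Longrightarrow> adj (Z \<alpha> \<beta> n) (Z \<alpha> \<beta> (Suc n))"
| Z_T: "\<lbrakk>\<alpha> < q; \<beta> < q; n < b\<rbrakk> \<Longrightarrow> adj (Z \<alpha> \<beta> n) (T \<alpha> \<beta> (a - 1))"
| Z_Q: "\<lbrakk>\<alpha> < q; \<beta> < q; \<kappa> < q\<rbrakk> \<Longrightarrow> adj (Z \<alpha> \<beta> (b - 1)) (Q \<alpha> \<kappa> 0)"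
| Q_Q: "\<lbrakk>\<alpha> < q; \<kappa> < q; Suc n < a\<rbrakk> \<Longrightarrow> adj (Q \<alpha> \<kappa> n) (Q \<alpha> \<kappa> (Suc n))"
| Q_Y: "\<lbrakk>\<alpha> < q; \<kappa> < q; c < q\<rbrakk> \<Longrightarrow> adj (Q \<alpha> \<kappa> (a - 1)) (Y \<kappa> c b)"
| Q_C: "\<lbrakk>\<alpha> < q; \<kappa> < q; n < a; entry \<alpha> v\<rbrakk> \<Longrightarrow> adj (Q \<alpha> \<kappa> n) v"
| Y_C: "\<lbrakk>\<alpha> < q; \<kappa> < q; c < q; b \<le> j; j \<le> g; entry \<alpha> v\<rbrakk> \<Longrightarrow> adj (Y \<kappa> c j) v"
| C_C: "\<lbrakk>\<alpha> < q; 1 \<le> m; Suc m < a\<rbrakk> \<Longrightarrow> adj (C \<alpha> (Suc m)) (C \<alpha> m)"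
| C_T: "\<lbrakk>\<alpha> < q; \<beta> < q; 1 < a\<rbrakk> \<Longrightarrow> adj (C \<alpha> 1) (T \<alpha> \<beta> 0)"
| T_Y: "inc \<alpha> \<beta> \<kappa> c \<Longrightarrow> adj (T \<alpha> \<beta> 0) (Y \<kappa> c 0)"
| Y_Y: "\<lbrakk>\<kappa> < q; c < q; j < g\<rbrakk> \<Longrightarrow> adj (Y \<kappa> c j) (Y \<kappa> c (Suc j))"
| Y_T: "inc \<alpha> \<beta> \<kappa> c \<Longrightarrow> adj (Y \<kappa> c (b - 1)) (T \<alpha> \<beta> 0)"
| Y_Q: "\<lbrakk>\<alpha> < q; \<kappa> < q; c < q\<rbrakk> \<Longrightarrow> adj (Y \<kappa> c (b - 1)) (Q \<alpha> \<kappa> 0)"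

definition edges :: "(vert \<times> vert) set" where
  "edges = {(u, v). adj u v}"

inductive_set verts :: "vert set" where
  T_verts: "\<lbrakk>\<alpha> < q; \<beta> < q; i \<le> a\<rbrakk> \<Longrightarrow> T \<alpha> \<beta> i \<in> verts"
| Z_verts: "\<lbrakk>\<alpha> < q; \<beta> < q; n < b\<rbrakk> \<Longrightarrow> Z \<alpha> \<beta> n \<in> verts"
| C_verts: "\<lbrakk>\<alpha> < q; 1 \<le> m; m < a\<rbrakk> \<Longrightarrow> C \<alpha> m \<in> verts"
| Q_verts: "\<lbrakk>\<alpha> < q; \<kappa> < q; n < a\<rbrakk> \<Longrightarrow> Q \<alpha> \<kappa> n \<in> verts"
| Y_verts: "\<lbrakk>\<kappa> < q; c < q; j \<le> g\<rbrakk> \<Longrightarrow> Y \<kappa> c j \<in> verts"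

lemma entry_cases:
  assumes "entry \<alpha> v"
  obtains \<beta> where "a = 1" "\<beta> < q" "v = T \<alpha> \<beta> 0" | "1 < a" "v = C \<alpha> (a - 1)"
proof -
  have "if a = 1 then \<exists>\<beta><q. v = T \<alpha> \<beta> 0 else v = C \<alpha> (a - 1)"
    using assms by (simp only: entry_def)
  with ab that show thesis by (cases "a = 1") auto
qed

lemma entry_verts:
  assumes "\<alpha> < q" "entry \<alpha> v"
  shows "v \<in> verts"
  using assms(2)
proof (cases rule: entry_cases)
  case (1 \<beta>)
  then show ?thesis using assms(1) T_verts[of \<alpha> \<beta> 0] by simp
next
  case 2
  then show ?thesis using assms(1) C_verts[of \<alpha> "a - 1"] by simp
qed

lemma adj_verts: "adj u v \<Longrightarrow> u \<in> verts \<and> v \<in> verts"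
  by (induction rule: adj.induct)
    (use ab g in \<open>auto intro!: verts.intros dest: inc_less entry_verts\<close>)

section \<open>Number of vertices\<close>

lemma verts_eq:
  "verts = (\<lambda>(\<alpha>, \<beta>, i). T \<alpha> \<beta> i) ` ({..<q} \<times> {..<q} \<times> {..a}) \<union>
    (\<lambda>(\<alpha>, \<beta>, n). Z \<alpha> \<beta> n) ` ({..<q} \<times> {..<q} \<times> {..<b}) \<union>
    (\<lambda>(\<alpha>, m). C \<alpha> m) ` ({..<q} \<times> {1..<a}) \<union>
    (\<lambda>(\<alpha>, \<kappa>, n). Q \<alpha> \<kappa> n) ` ({..<q} \<times> {..<q} \<times> {..<a}) \<union>
    (\<lambda>(\<kappa>, c, j). Y \<kappa> c j) ` ({..<q} \<times> {..<q} \<times> {..g})"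
  by (auto simp: image_iff elim!: verts.cases intro!: verts.intros)

lemma finite_verts: "finite verts"
  unfolding verts_eq by simp

lemma card_verts_le: "card verts \<le> 3 * (q\<^sup>2 * (a + 1 + g))"
proof -
  have "card verts \<le> q * q * (a + 1) + q * q * b + q * (a - 1) + q * q * a + q * q * (g + 1)"
    unfolding verts_eq
    by (intro order.trans[OF card_Un_le] add_mono order.trans[OF card_image_le])
      (auto simp: algebra_simps)
  also have "q * (a - 1) \<le> q * q * a"
  proof -
    have "1 * (a - 1) \<le> q * a" using q_pos by (intro mult_le_mono) auto
    then show ?thesis by simp
  qed
  also have "q * q * (a + 1) + q * q * b + q * q * a + q * q * a + q * q * (g + 1)
      = q * q * (3 * a + b + g + 2)" by (simp add: algebra_simps)
  also have "\<dots> \<le> q * q * (3 * (a + 1 + g))" using ab g by (intro mult_left_mono) auto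
  finally show ?thesis by (simp add: power2_eq_square algebra_simps)
qed

lemma card_verts_ge: "q\<^sup>2 * (a + 1 + g) \<le> card verts"
proof -
  let ?T = "(\<lambda>(\<alpha>, \<beta>, i). T \<alpha> \<beta> i) ` ({..<q} \<times> {..<q} \<times> {..a})"
  let ?Y = "(\<lambda>(\<kappa>, c, j). Y \<kappa> c j) ` ({..<q} \<times> {..<q} \<times> {..g})"
  have "card ?T = q * q * (a + 1)"
    by (subst card_image) (auto simp: inj_on_def algebra_simps)
  moreover have "card ?Y = q * q * (g + 1)"
    by (subst card_image) (auto simp: inj_on_def algebra_simps)
  moreover have "card (?T \<union> ?Y) = card ?T + card ?Y" by (rule card_Un_disjoint) auto
  moreover have "card (?T \<union> ?Y) \<le> card verts"
    by (intro card_mono finite_verts) (unfold verts_eq, blast)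
  ultimately have "q * q * (a + 1) + q * q * (g + 1) \<le> card verts" by simp
  then show ?thesis by (simp add: power2_eq_square algebra_simps)
qed

lemma digraph_edges: "digraph verts edges"
proof -
  have "\<not> adj v v" for v
    using ab by (auto elim!: adj.cases entry_cases)
  then show ?thesis using adj_verts finite_verts by (auto simp: digraph_def edges_def)
qed

section \<open>Upper bounds on distances\<close>

definition near :: "nat \<Rightarrow> vert \<Rightarrow> vert \<Rightarrow> bool" where
  "near k u v \<longleftrightarrow> (\<exists>j\<le>k. (u, v) \<in> edges ^^ j)"

lemma near_refl: "near k u u"
  unfolding near_def by (rule exI[of _ 0]) simp

lemma near_adj: "adj u v \<Longrightarrow> near 1 u v"
  unfolding near_def by (rule exI[of _ 1]) (simp add: edges_def)

lemma near_trans: "near k u v \<Longrightarrow> near l v w \<Longrightarrow> k + l \<le> n \<Longrightarrow> near n u w"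
  unfolding near_def
proof (elim exE conjE)
  fix i j assume "i \<le> k" "(u, v) \<in> edges ^^ i" "j \<le> l" "(v, w) \<in> edges ^^ j" "k + l \<le> n"
  then show "\<exists>j\<le>n. (u, w) \<in> edges ^^ j" by (intro exI[of _ "i + j"]) (auto simp: relpow_add)
qed

lemma near_mono: "near k u v \<Longrightarrow> k \<le> l \<Longrightarrow> near l u v"
  unfolding near_def by (meson order.trans)

lemma near_adj_trans: "adj u v \<Longrightarrow> near l v w \<Longrightarrow> Suc l \<le> n \<Longrightarrow> near n u w"
  using near_trans[OF near_adj] by simp

lemma near_trans_adj: "near k u v \<Longrightarrow> adj v w \<Longrightarrow> Suc k \<le> n \<Longrightarrow> near n u w"
  using near_trans[OF _ near_adj] by simp

lemma near_T_0: "\<lbrakk>\<alpha> < q; \<beta> < q; i \<le> a\<rbrakk> \<Longrightarrow> near i (T \<alpha> \<beta> i) (T \<alpha> \<beta> 0)"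
  by (induction i) (simp_all add: near_refl near_adj_trans[OF T_down _ order.refl])

lemma near_Z_Z: "\<lbrakk>n \<le> n'; \<alpha> < q; \<beta> < q; n' < b\<rbrakk> \<Longrightarrow> near (n' - n) (Z \<alpha> \<beta> n) (Z \<alpha> \<beta> n')"
  by (induction n' rule: dec_induct)
    (simp_all add: near_refl Suc_diff_le near_trans_adj[OF _ Z_Z order.refl])

lemma near_Q_Q: "\<lbrakk>n \<le> n'; \<alpha> < q; \<kappa> < q; n' < a\<rbrakk> \<Longrightarrow> near (n' - n) (Q \<alpha> \<kappa> n) (Q \<alpha> \<kappa> n')"
  by (induction n' rule: dec_induct)
    (simp_all add: near_refl Suc_diff_le near_trans_adj[OF _ Q_Q order.refl])

lemma near_Y_Y: "\<lbrakk>j \<le> j'; \<kappa> < q; c < q; j' \<le> g\<rbrakk> \<Longrightarrow> near (j' - j) (Y \<kappa> c j) (Y \<kappa> c j')"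
  by (induction j' rule: dec_induct)
    (simp_all add: near_refl Suc_diff_le near_trans_adj[OF _ Y_Y order.refl])

lemma near_C_C: "\<lbrakk>m \<le> m'; \<alpha> < q; 1 \<le> m; m' < a\<rbrakk> \<Longrightarrow> near (m' - m) (C \<alpha> m') (C \<alpha> m)"
  by (induction m' rule: dec_induct)
    (simp_all add: near_refl Suc_diff_le near_adj_trans[OF C_C _ order.refl])

lemma near_C_T: "\<lbrakk>\<alpha> < q; \<beta> < q; 1 \<le> m; m < a\<rbrakk> \<Longrightarrow> near m (C \<alpha> m) (T \<alpha> \<beta> 0)"
  using near_trans_adj[OF near_C_C[of 1 m \<alpha>] C_T[of \<alpha> \<beta>], of m] by simp

lemma near_entry_T:
  assumes "\<And>v. entry \<alpha> v \<Longrightarrow> adj u v" "\<alpha> < q" "\<beta> < q"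
  shows "near a u (T \<alpha> \<beta> 0)"
proof (cases "a = 1")
  case True
  then have "entry \<alpha> (T \<alpha> \<beta> 0)" using assms(3) unfolding entry_def by auto
  then have "near 1 u (T \<alpha> \<beta> 0)" by (intro near_adj assms(1))
  with True show ?thesis by simp
next
  case False
  then have "near (a - 1) (C \<alpha> (a - 1)) (T \<alpha> \<beta> 0)" "adj u (C \<alpha> (a - 1))"
    using ab assms by (auto intro: near_C_T simp: entry_def)
  then show ?thesis using ab by (auto intro: near_adj_trans)
qed

lemma near_entry_C:
  assumes "\<And>v. entry \<alpha> v \<Longrightarrow> adj u v" "\<alpha> < q" "1 \<le> m" "m < a"
  shows "near (a - m) u (C \<alpha> m)"
proof -
  have "near (a - 1 - m) (C \<alpha> (a - 1)) (C \<alpha> m)" "adj u (C \<alpha> (a - 1))"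
    using near_C_C[of m "a - 1" \<alpha>] assms by (auto simp: entry_def)
  then show ?thesis using assms by (auto intro: near_adj_trans)
qed

lemma near_Q_T: "\<lbrakk>\<alpha> < q; \<kappa> < q; n < a; \<beta> < q\<rbrakk> \<Longrightarrow> near a (Q \<alpha> \<kappa> n) (T \<alpha> \<beta> 0)"
  by (rule near_entry_T) (auto intro: Q_C)

lemma near_Y_T: "\<lbrakk>\<kappa> < q; c < q; b \<le> j; j \<le> g; \<alpha> < q; \<beta> < q\<rbrakk> \<Longrightarrow> near a (Y \<kappa> c j) (T \<alpha> \<beta> 0)"
  by (rule near_entry_T) (auto intro: Y_C)

lemma near_Y_return: "\<lbrakk>inc \<alpha> \<beta> \<kappa> c; j < b\<rbrakk> \<Longrightarrow> near (b - j) (Y \<kappa> c j) (T \<alpha> \<beta> 0)"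
  using near_trans_adj[OF near_Y_Y[of j "b - 1" \<kappa> c] Y_T, of \<alpha> \<beta> "b - j"] g inc_less[of \<alpha> \<beta> \<kappa> c]
  by auto

lemma near_T_Y: "\<lbrakk>inc \<alpha> \<beta> \<kappa> c; j \<le> g\<rbrakk> \<Longrightarrow> near (Suc j) (T \<alpha> \<beta> 0) (Y \<kappa> c j)"
  using near_adj_trans[OF T_Y near_Y_Y[of 0 j \<kappa> c]] inc_less[of \<alpha> \<beta> \<kappa> c] by auto

lemma near_Z_T: "\<lbrakk>\<alpha> < q; \<beta> < q; n < b\<rbrakk> \<Longrightarrow> near a (Z \<alpha> \<beta> n) (T \<alpha> \<beta> 0)"
  using ab by (intro near_adj_trans[OF Z_T near_T_0]) auto

lemma near_Z_Q: "\<lbrakk>\<alpha> < q; \<beta> < q; \<kappa> < q; n < b\<rbrakk> \<Longrightarrow> near (b - n) (Z \<alpha> \<beta> n) (Q \<alpha> \<kappa> 0)"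
  using near_trans_adj[OF near_Z_Z[of n "b - 1" \<alpha> \<beta>] Z_Q, of \<kappa> "b - n"] by auto

lemma near_T_Q: "\<lbrakk>\<alpha> < q; \<beta> < q; \<kappa> < q; i \<le> a\<rbrakk> \<Longrightarrow> near (Suc b) (T \<alpha> \<beta> i) (Q \<alpha> \<kappa> 0)"
  using near_adj_trans[OF T_Z near_Z_Q[of \<alpha> \<beta> \<kappa> 0]] ab by auto

lemma near_Q_Y:
  "\<lbrakk>\<alpha> < q; \<kappa> < q; c < q; b \<le> j; j \<le> g\<rbrakk> \<Longrightarrow> near (a + (j - b)) (Q \<alpha> \<kappa> 0) (Y \<kappa> c j)"
  using near_trans[OF near_trans_adj[OF near_Q_Q[of 0 "a - 1" \<alpha> \<kappa>] Q_Y[of \<alpha> \<kappa> c], of a]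
      near_Y_Y[of b j \<kappa> c]] ab by auto

lemma near_Y_Q:
  "\<lbrakk>\<alpha> < q; \<kappa> < q; c < q; j < b\<rbrakk> \<Longrightarrow> near (b - j) (Y \<kappa> c j) (Q \<alpha> \<kappa> 0)"
  using near_trans_adj[OF near_Y_Y[of j "b - 1" \<kappa> c] Y_Q, of \<alpha> "b - j"] g by auto

text \<open>Follow the joining line: one edge onto its path, b - 1 edges along it, and one edge back
  to the other point.\<close>

lemma near_T_T:
  assumes "\<alpha> < q" "\<beta> < q" "\<alpha>' < q" "\<beta>' < q" "\<alpha> \<noteq> \<alpha>'"
  shows "near (b + 1) (T \<alpha> \<beta> 0) (T \<alpha>' \<beta>' 0)"
proof -
  obtain \<kappa> c where "inc \<alpha> \<beta> \<kappa> c" "inc \<alpha>' \<beta>' \<kappa> c" using join_ex[OF assms] by blast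
  then show ?thesis using near_trans[OF near_T_Y near_Y_return, of \<alpha> \<beta> \<kappa> c 0 \<alpha>' \<beta>'] ab by auto
qed

lemma near_some_T:
  assumes "v \<in> verts"
  obtains \<alpha> \<beta> where "\<alpha> < q" "\<beta> < q" "near a v (T \<alpha> \<beta> 0)"
proof -
  have "\<exists>\<alpha><q. \<exists>\<beta><q. near a v (T \<alpha> \<beta> 0)"
    using assms
  proof cases
    case (T_verts \<alpha> \<beta> i)
    then show ?thesis using near_T_0 near_mono by blast
  next
    case (Z_verts \<alpha> \<beta> n)
    then show ?thesis using near_Z_T by blast
  next
    case (C_verts \<alpha> m)
    then show ?thesis using near_C_T[of \<alpha> 0 m] near_mono q_pos by (metis less_imp_le)
  next
    case (Q_verts \<alpha> \<kappa> n)
    then show ?thesis using near_Q_T q_pos by blast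
  next
    case (Y_verts \<kappa> c j)
    show ?thesis
    proof (cases "b \<le> j")
      case True
      then show ?thesis using near_Y_T Y_verts q_pos by blast
    next
      case False
      obtain \<beta> where "inc 0 \<beta> \<kappa> c" using point_ex[of 0 \<kappa> c] Y_verts q_pos by blast
      then show ?thesis
        using False near_Y_return[of 0 \<beta> \<kappa> c j] Y_verts ab inc_less[of 0 \<beta> \<kappa> c] near_mono
        by (metis diff_le_self not_le order.trans)
    qed
  qed
  then show ?thesis using that by blast
qed

text \<open>From a point or \<open>Z\<close> vertex in another column, reach its \<open>T\<close>
  vertex within \<open>a\<close> and add b + 1 along a joining line. In the same column, the detour
  through \<open>Q\<close> and the return path reaches every point. A line vertex moves up to index
  \<open>b\<close>, if below it, and returns into any column.\<close>

lemma near_T: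
  assumes v: "v \<in> verts" and \<alpha>': "\<alpha>' < q" "\<beta>' < q"
  shows "near (a + b + 1) v (T \<alpha>' \<beta>' 0)"
proof -
  have far: ?thesis if "near a v (T \<alpha> \<beta> 0)" "\<alpha> < q" "\<beta> < q" "\<alpha> \<noteq> \<alpha>'" for \<alpha> \<beta>
    using near_trans[OF that(1) near_T_T] that(2-) \<alpha>' by simp
  from v show ?thesis
  proof cases
    case (T_verts \<alpha> \<beta> i)
    then show ?thesis
      using far[of \<alpha> \<beta>] near_mono[OF near_T_0] near_trans[OF near_T_Q[of \<alpha> \<beta> 0 i] near_Q_T] \<alpha>' ab q_pos
      by (cases "\<alpha> = \<alpha>'") auto
  next
    case (Z_verts \<alpha> \<beta> n)
    then show ?thesis
      using far[of \<alpha> \<beta>] near_Z_T near_trans[OF near_Z_Q[of \<alpha> \<beta> 0 n] near_Q_T] \<alpha>' ab q_pos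
      by (cases "\<alpha> = \<alpha>'") auto
  next
    case (C_verts \<alpha> m)
    then show ?thesis
      using far[of \<alpha> 0] near_mono[OF near_C_T] \<alpha>' q_pos by (cases "\<alpha> = \<alpha>'") auto
  next
    case (Q_verts \<alpha> \<kappa> n)
    then show ?thesis
      using far[of \<alpha> 0] near_Q_T near_mono[OF near_Q_T] \<alpha>' q_pos by (cases "\<alpha> = \<alpha>'") auto
  next
    case (Y_verts \<kappa> c j)
    show ?thesis
    proof (cases "b \<le> j")
      case True
      then show ?thesis using near_mono[OF near_Y_T] Y_verts \<alpha>' by auto
    next
      case False
      then show ?thesis
        using near_trans[OF near_Y_Y[of j b \<kappa> c] near_Y_T] Y_verts \<alpha>' g by auto
    qed
  qed
qed

lemma near_Y:
  assumes v: "v \<in> verts" and \<kappa>: "\<kappa> < q" "c < q" "j \<le> g"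
  shows "near (a + 1 + g) v (Y \<kappa> c j)"
proof (cases "b \<le> j")
  case False
  obtain \<beta> where "inc 0 \<beta> \<kappa> c" using point_ex[of 0 \<kappa> c] \<kappa> q_pos by blast
  \<comment> \<open>The total is a + b + 2 + j, and b + 1 + j \<le> 2b \<le> g because j <
    b.\<close>
  then show ?thesis
    using near_trans[OF near_T[OF v, of 0 \<beta>] near_T_Y[of 0 \<beta> \<kappa> c j]] False \<kappa> g inc_less[of 0 \<beta> \<kappa> c]
    by auto
next
  case True
  \<comment> \<open>A vertex that reaches a whole column within \<open>a\<close> may pick the point
    of that column on the target line.\<close>
  have via_T: ?thesis if near_a: "\<And>\<beta>. \<beta> < q \<Longrightarrow> near a v (T \<alpha> \<beta> 0)" and "\<alpha> < q" for \<alpha>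
  proof -
    obtain \<beta> where "inc \<alpha> \<beta> \<kappa> c" using point_ex[of \<alpha> \<kappa> c] \<kappa> \<open>\<alpha> < q\<close> by blast
    then show ?thesis
      using near_trans[OF near_a near_T_Y[of \<alpha> \<beta> \<kappa> c j]] \<kappa> inc_less[of \<alpha> \<beta> \<kappa> c] by auto
  qed
  from v show ?thesis
  proof cases
    case (T_verts \<alpha> \<beta> i)
    then show ?thesis using near_trans[OF near_T_Q near_Q_Y] \<kappa> True by auto
  next
    case (Z_verts \<alpha> \<beta> n)
    then show ?thesis using near_trans[OF near_Z_Q near_Q_Y] \<kappa> True by auto
  next
    case (C_verts \<alpha> m)
    then show ?thesis using via_T[of \<alpha>] near_mono[OF near_C_T[of \<alpha> _ m], of _ a] by simp
  next
    case (Q_verts \<alpha> \<kappa>' n)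
    then show ?thesis using via_T[of \<alpha>] near_Q_T[of \<alpha> \<kappa>' n] by simp
  next
    case (Y_verts \<kappa>' c' j')
    consider "b \<le> j'" | "j' < b" "\<kappa> = \<kappa>'" | "j' < b" "\<kappa> \<noteq> \<kappa>'" by linarith
    then show ?thesis
    proof cases
      case 1
      then show ?thesis using via_T[of 0] near_Y_T[of \<kappa>' c' j' 0] Y_verts q_pos by simp
    next
      case 2
      then show ?thesis using near_trans[OF near_Y_Q[of 0] near_Q_Y] Y_verts \<kappa> True q_pos by auto
    next
      case 3
      then obtain \<alpha> \<beta> where "inc \<alpha> \<beta> \<kappa>' c'" "inc \<alpha> \<beta> \<kappa> c" using meet_ex[of \<kappa>' c' \<kappa> c] Y_verts \<kappa> by auto
      then show ?thesis
        using near_trans[OF near_Y_return near_T_Y] 3 Y_verts \<kappa> ab by auto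
    qed
  qed
qed

lemma near_verts:
  assumes v: "v \<in> verts" and w: "w \<in> verts"
  shows "near (a + 1 + g) v w"
  using w
proof cases
  case (T_verts \<alpha> \<beta> i)
  then show ?thesis
    using near_mono[OF near_T[OF v]] near_trans_adj[OF near_T[OF v] T_up] g ab by (cases "i = 0") auto
next
  case (Z_verts \<alpha> \<beta> n)
  then have "near (a + b + 2) v (Z \<alpha> \<beta> 0)"
    using near_trans_adj[OF near_T[OF v] T_Z] by auto
  then show ?thesis using near_trans[OF _ near_Z_Z[of 0 n \<alpha> \<beta>]] Z_verts g by auto
next
  case (C_verts \<alpha> m)
  obtain \<alpha>' \<beta> where "\<alpha>' < q" "\<beta> < q" and *: "near a v (T \<alpha>' \<beta> 0)" using near_some_T[OF v] .
  \<comment> \<open>Any line through the point will do, since \<open>Y 0 c b\<close> leads into the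
    return path of every column. The total 2a + b + 1 - m fits because m \<ge> 1 and a + b \<le> g +
    1.\<close>
  then obtain c where "inc \<alpha>' \<beta> 0 c" using line_ex[of \<alpha>' \<beta> 0] q_pos by blast
  then have "near (a + b + 1) v (Y 0 c b)" "c < q"
    using near_trans[OF * near_T_Y] g inc_less by auto
  moreover have "near (a - m) (Y 0 c b) (C \<alpha> m)"
    using C_verts \<open>c < q\<close> g q_pos by (intro near_entry_C) (auto intro: Y_C)
  ultimately show ?thesis using near_trans C_verts g by auto
next
  case (Q_verts \<alpha> \<kappa> n)
  obtain \<alpha>' \<beta> where "\<alpha>' < q" "\<beta> < q" and *: "near a v (T \<alpha>' \<beta> 0)" using near_some_T[OF v] .
  \<comment> \<open>The line needs the slope \<open>\<kappa>\<close> of the target: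
    \<open>Y_Q\<close> changes the column but keeps the slope.\<close>
  then obtain c where "inc \<alpha>' \<beta> \<kappa> c" using line_ex[of \<alpha>' \<beta> \<kappa>] Q_verts by blast
  then have "near (a + 1) v (Y \<kappa> c 0)" "c < q"
    using near_trans[OF * near_T_Y] g inc_less by auto
  then have "near (a + 1 + b) v (Q \<alpha> \<kappa> 0)"
    using near_trans[OF _ near_Y_Q] Q_verts ab by auto
  then show ?thesis using near_trans[OF _ near_Q_Q[of 0 n \<alpha> \<kappa>]] Q_verts g by auto
next
  case (Y_verts \<kappa> c j)
  then show ?thesis using near_Y[OF v] by simp
qed

section \<open>Lower bounds on walk lengths by potentials\<close>

lemma walk_ge:
  assumes "inc \<alpha>\<^sub>0 \<beta>\<^sub>0 \<kappa>\<^sub>0 c\<^sub>0" "(T \<alpha>\<^sub>0 \<beta>\<^sub>0 a, Y \<kappa>\<^sub>0 c\<^sub>0 g) \<in> edges ^^ j"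
  shows "a + 1 + g \<le> j"
proof -
  \<comment> \<open>Along both short routes the value counts the edges travelled. Elsewhere it is
    \<open>a\<close>, except that the paths \<open>Q\<close> of slope
    \<open>\<kappa>\<^sub>0\<close> are treated alike in all columns. The condition b \<le> a \<le>
    b + 1 makes crossings between these values harmless.\<close>
  define \<phi> where "\<phi> v = (case v of
      T \<alpha> \<beta> i \<Rightarrow> if \<alpha> = \<alpha>\<^sub>0 \<and> \<beta> = \<beta>\<^sub>0 then a - i else a
    | Z \<alpha> \<beta> n \<Rightarrow> if \<alpha> = \<alpha>\<^sub>0 \<and> \<beta> = \<beta>\<^sub>0 then n + 1 else a
    | C \<alpha> m \<Rightarrow> a
    | Q \<alpha> \<kappa> n \<Rightarrow> if \<kappa> = \<kappa>\<^sub>0 then b + 1 + n else a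
    | Y \<kappa> c j \<Rightarrow> if \<kappa> = \<kappa>\<^sub>0 \<and> c = c\<^sub>0 then a + 1 + j else a)" for v
  have "\<phi> v \<le> \<phi> u + 1" if "adj u v" for u v
    using that
  proof cases
    case (Q_C \<alpha> \<kappa> n)
    from \<open>entry \<alpha> v\<close> show ?thesis by (cases rule: entry_cases) (use Q_C(1) ab in \<open>auto simp: \<phi>_def\<close>)
  next
    case (Y_C \<alpha> \<kappa> c j)
    from \<open>entry \<alpha> v\<close> show ?thesis by (cases rule: entry_cases) (use Y_C(1) ab in \<open>auto simp: \<phi>_def\<close>)
  qed (use ab in \<open>auto simp: \<phi>_def\<close>)
  then have "\<phi> (Y \<kappa>\<^sub>0 c\<^sub>0 g) \<le> \<phi> (T \<alpha>\<^sub>0 \<beta>\<^sub>0 a) + j"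
    by (intro potential_relpow[OF assms(2)]) (simp add: edges_def)
  then show ?thesis by (simp add: \<phi>_def)
qed

lemma walk_avoiding_ge:
  assumes inc\<^sub>0: "inc \<alpha>\<^sub>0 \<beta>\<^sub>0 \<kappa>\<^sub>0 c\<^sub>0"
    and walk: "(T \<alpha>\<^sub>0 \<beta>\<^sub>0 a, Y \<kappa>\<^sub>0 c\<^sub>0 g) \<in> (edges - {(T \<alpha>\<^sub>0 \<beta>\<^sub>0 0, Y \<kappa>\<^sub>0 c\<^sub>0 0),
      (Z \<alpha>\<^sub>0 \<beta>\<^sub>0 (b - 1), Q \<alpha>\<^sub>0 \<kappa>\<^sub>0 0)}) ^^ j"
  shows "2 * a + b + 1 + g \<le> j"
proof -
  \<comment> \<open>\<open>\<phi> v\<close> is a lower bound for the distance from \<open>T \<alpha>\<^sub>0 \<beta>\<^sub>0 a\<close> to \<open>v\<close> in the remaining graph.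
    Without the two edges, the line \<open>(\<kappa>\<^sub>0, c\<^sub>0)\<close> must be entered from another of its points,
    and these are far away, since two points have only one line in common.\<close>
  define \<tau> where "\<tau> \<alpha> \<beta> = (if inc \<alpha> \<beta> \<kappa>\<^sub>0 c\<^sub>0 then 2 * a + b else a + b + 1)" for \<alpha> \<beta>
  define \<phi> where "\<phi> v = (case v of
      T \<alpha> \<beta> i \<Rightarrow> if \<alpha> = \<alpha>\<^sub>0 \<and> \<beta> = \<beta>\<^sub>0 then a - i else \<tau> \<alpha> \<beta>
    | Z \<alpha> \<beta> n \<Rightarrow> if \<alpha> = \<alpha>\<^sub>0 \<and> \<beta> = \<beta>\<^sub>0 then n + 1 else \<tau> \<alpha> \<beta> + n + 1
    | C \<alpha> m \<Rightarrow> if \<alpha> = \<alpha>\<^sub>0 then a + b + 1 - m else 2 * a + b - m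
    | Q \<alpha> \<kappa> n \<Rightarrow> if \<kappa> = \<kappa>\<^sub>0 then a + 2 * b + 2 + n else if \<alpha> = \<alpha>\<^sub>0 then b + 1 + n else a + b + 1 + n
    | Y \<kappa> c j \<Rightarrow> if \<kappa> = \<kappa>\<^sub>0 \<and> c = c\<^sub>0 then 2 * a + b + 1 + j else if b \<le> j then a + j
        else if inc \<alpha>\<^sub>0 \<beta>\<^sub>0 \<kappa> c then a + 1 + j else a + b + 2 + j)" for v
  have \<tau>_ge: "a + b + 1 \<le> \<tau> \<alpha> \<beta>" and \<tau>_le: "\<tau> \<alpha> \<beta> \<le> 2 * a + b" for \<alpha> \<beta>
    using ab by (auto simp: \<tau>_def)
  \<comment> \<open>The line meets the start column only in the start point, so the quick return
    through \<open>C \<alpha>\<^sub>0\<close> yields only points off the line.\<close>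
  have \<tau>_column: "\<tau> \<alpha>\<^sub>0 \<beta> = a + b + 1" if "\<beta> \<noteq> \<beta>\<^sub>0" for \<beta>
    using that point_unique[OF inc\<^sub>0] by (auto simp: \<tau>_def)
  \<comment> \<open>When \<open>a = 1\<close> the return lands directly on points, where even 2a + b
    equals a + b + 1.\<close>
  have entry_le: "\<phi> v \<le> (if \<alpha> = \<alpha>\<^sub>0 then b + 2 else a + b + 1)" if "entry \<alpha> v" for \<alpha> v
    using that
  proof (cases rule: entry_cases)
    case (1 \<beta>)
    then show ?thesis using ab \<tau>_column[of \<beta>] \<tau>_le[of \<alpha> \<beta>] by (auto simp: \<phi>_def)
  next
    case 2
    then show ?thesis using ab by (auto simp: \<phi>_def)
  qed
  have "\<phi> v \<le> \<phi> u + 1"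
    if "adj u v" and ne: "(u, v) \<noteq> (T \<alpha>\<^sub>0 \<beta>\<^sub>0 0, Y \<kappa>\<^sub>0 c\<^sub>0 0)" "(u, v) \<noteq> (Z \<alpha>\<^sub>0 \<beta>\<^sub>0 (b - 1), Q \<alpha>\<^sub>0 \<kappa>\<^sub>0 0)" for u v
    using that(1)
  proof cases
    case (Z_Q \<alpha> \<beta> \<kappa>)
    then show ?thesis using ne ab \<tau>_ge[of \<alpha> \<beta>] by (auto simp: \<phi>_def)
  next
    case (Q_C \<alpha> \<kappa> n)
    then show ?thesis using entry_le[OF \<open>entry \<alpha> v\<close>] by (auto simp: \<phi>_def)
  next
    case (Y_C \<alpha> \<kappa> c j)
    then have "a + b \<le> \<phi> u" by (auto simp: \<phi>_def)
    then show ?thesis using entry_le[OF \<open>entry \<alpha> v\<close>] ab by (simp split: if_splits)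
  next
    case (C_T \<alpha> \<beta>)
    then show ?thesis using ab \<tau>_column[of \<beta>] \<tau>_le[of \<alpha> \<beta>] by (auto simp: \<phi>_def)
  next
    case (T_Y \<alpha> \<beta> \<kappa> c)
    show ?thesis
    proof (cases "\<alpha> = \<alpha>\<^sub>0 \<and> \<beta> = \<beta>\<^sub>0")
      case True
      \<comment> \<open>The line of slope \<open>\<kappa>\<^sub>0\<close> through the start point is
        unique and its edge has been removed.\<close>
      then have "\<kappa> \<noteq> \<kappa>\<^sub>0" using ne(1) T_Y line_unique[OF inc\<^sub>0, of c] by auto
      then show ?thesis using True T_Y ab by (simp add: \<phi>_def)
    next
      case x: False
      show ?thesis
      proof (cases "\<kappa> = \<kappa>\<^sub>0 \<and> c = c\<^sub>0")
        case True
        then have "\<phi> u = 2 * a + b" "\<phi> v = 2 * a + b + 1" using x T_Y by (auto simp: \<phi>_def \<tau>_def)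
        then show ?thesis by simp
      next
        case False
        then have "\<phi> v \<le> a + b + 2" using T_Y ab by (auto simp: \<phi>_def)
        moreover have "\<phi> u = \<tau> \<alpha> \<beta>" using x T_Y by (auto simp: \<phi>_def)
        ultimately show ?thesis using \<tau>_ge[of \<alpha> \<beta>] by simp
      qed
    qed
  next
    case (Y_T \<alpha> \<beta> \<kappa> c)
    have \<phi>_u: "a + b \<le> \<phi> u" using Y_T ab by (auto simp: \<phi>_def)
    show ?thesis
    proof (cases "\<alpha> = \<alpha>\<^sub>0 \<and> \<beta> = \<beta>\<^sub>0")
      case True
      then show ?thesis using \<phi>_u Y_T by (simp add: \<phi>_def)
    next
      case x: False
      then have \<phi>_v: "\<phi> v = \<tau> \<alpha> \<beta>" using Y_T by (auto simp: \<phi>_def)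
      show ?thesis
      proof (cases "inc \<alpha> \<beta> \<kappa>\<^sub>0 c\<^sub>0 \<and> \<not> (\<kappa> = \<kappa>\<^sub>0 \<and> c = c\<^sub>0)")
        case True
        \<comment> \<open>A second line through a point of the special line cannot also pass through
          the start point, so it was itself entered late.\<close>
        then have "\<not> inc \<alpha>\<^sub>0 \<beta>\<^sub>0 \<kappa> c"
          using x Y_T inc\<^sub>0 join_unique[of \<alpha> \<beta> \<kappa> c \<alpha>\<^sub>0 \<beta>\<^sub>0 \<kappa>\<^sub>0 c\<^sub>0] by blast
        then have "\<phi> u = a + b + 2 + (b - 1)" using True Y_T ab by (auto simp: \<phi>_def)
        then show ?thesis using \<phi>_v \<tau>_le[of \<alpha> \<beta>] ab by simp
      next
        case False
        then consider "\<kappa> = \<kappa>\<^sub>0" "c = c\<^sub>0" | "\<tau> \<alpha> \<beta> = a + b + 1" by (auto simp: \<tau>_def)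
        then show ?thesis
        proof cases
          case 1
          then have "\<phi> u = 2 * a + b + 1 + (b - 1)" using Y_T by (simp add: \<phi>_def)
          then show ?thesis using \<phi>_v \<tau>_le[of \<alpha> \<beta>] by simp
        qed (use \<phi>_u \<phi>_v in simp)
      qed
    qed
  next
    case (Y_Q \<alpha> \<kappa> c)
    \<comment> \<open>A line of slope \<open>\<kappa>\<^sub>0\<close> is either the special line or
      misses the start point; both give \<open>Y\<close> a value high enough for the jump to
      \<open>Q\<close>.\<close>
    then show ?thesis using ab line_unique[OF inc\<^sub>0, of c] by (auto simp: \<phi>_def)
  next
    case (Y_Y \<kappa> c j)
    then show ?thesis using ab by (auto simp: \<phi>_def)
  qed (use ab in \<open>auto simp: \<phi>_def\<close>)
  then have "\<phi> (Y \<kappa>\<^sub>0 c\<^sub>0 g) \<le> \<phi> (T \<alpha>\<^sub>0 \<beta>\<^sub>0 a) + j"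
    by (intro potential_relpow[OF walk]) (auto simp: edges_def)
  then show ?thesis by (simp add: \<phi>_def)
qed

section \<open>Diameter and forced edges\<close>

lemma diam_edges: "diam_G verts edges = enat (a + 1 + g)"
proof -
  obtain c where c: "inc 0 0 0 c" using line_ex[of 0 0 0] q_pos by blast
  show ?thesis
  proof (rule diam_G_eqI)
    show "T 0 0 a \<in> verts" "Y 0 c g \<in> verts" using q_pos inc_less[OF c] by (auto intro: T_verts Y_verts)
  qed (use near_verts walk_ge[OF c] in \<open>auto simp: near_def\<close>)
qed

text \<open>With D = a + 1 + g, the assumption says that the length forced by losing both edges of
  an incident pair is at least 5D/3 - 1. Incident pairs are indexed by triples
  \<open>\<alpha>\<close>, \<open>\<beta>\<close>, \<open>\<kappa>\<close>, as these determine the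
  line.\<close>

lemma hard_graph_edges:
  assumes "5 * (a + 1 + g) \<le> 3 * (2 * a + b + 1 + g) + 3"
  shows "hard_graph verts edges (a + 1 + g) (q ^ 3)"
proof -
  have "q ^ 3 \<le> card E'"
    if E': "E' \<subseteq> edges" "diam_G verts E' = enat k" "3 * k + 3 < 5 * (a + 1 + g)" for E' k
  proof -
    define e where "e \<alpha> \<beta> \<kappa> = (T \<alpha> \<beta> 0, Y \<kappa> (SOME c. inc \<alpha> \<beta> \<kappa> c) 0)" for \<alpha> \<beta> \<kappa>
    define f where "f \<alpha> \<beta> \<kappa> = (Z \<alpha> \<beta> (b - 1), Q \<alpha> \<kappa> 0)" for \<alpha> \<beta> \<kappa>
    have e_f: "e \<alpha> \<beta> \<kappa> \<in> E' \<or> f \<alpha> \<beta> \<kappa> \<in> E'" if "\<alpha> < q" "\<beta> < q" "\<kappa> < q" for \<alpha> \<beta> \<kappa>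
    proof (rule ccontr)
      define c where "c = (SOME c. inc \<alpha> \<beta> \<kappa> c)"
      have inc: "inc \<alpha> \<beta> \<kappa> c" unfolding c_def using line_ex[OF that] by (rule someI_ex)
      assume "\<not> ?thesis"
      then have sub: "E' \<subseteq> edges - {(T \<alpha> \<beta> 0, Y \<kappa> c 0), (Z \<alpha> \<beta> (b - 1), Q \<alpha> \<kappa> 0)}"
        using E'(1) by (auto simp: e_def f_def c_def)
      have "T \<alpha> \<beta> a \<in> verts" "Y \<kappa> c g \<in> verts"
        using that inc_less[OF inc] by (auto intro: T_verts Y_verts)
      moreover have "diam_G verts E' \<le> enat k" using E'(2) by simp
      ultimately obtain l where "l \<le> k" "(T \<alpha> \<beta> a, Y \<kappa> c g) \<in> E' ^^ l"
        unfolding diam_G_le_iff by blast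
      with walk_avoiding_ge[OF inc subsetD[OF relpow_subset[OF sub]]]
      have "2 * a + b + 1 + g \<le> k" by (meson order.trans)
      then show False using assms E'(3) by (simp add: algebra_simps)
    qed
    \<comment> \<open>One surviving edge is chosen per triple. Each edge reveals its triple, and the
      two kinds start at different kinds of vertices, so the choice is injective.\<close>
    define h where "h = (\<lambda>(\<alpha>, \<beta>, \<kappa>). if e \<alpha> \<beta> \<kappa> \<in> E' then e \<alpha> \<beta> \<kappa> else f \<alpha> \<beta> \<kappa>)"
    let ?I = "{..<q} \<times> {..<q} \<times> {..<q}"
    have "h ` ?I \<subseteq> E'" using e_f by (intro image_subsetI) (auto simp: h_def split: prod.splits)
    moreover have "finite edges"
      using digraph_edges finite_verts finite_subset[of edges "verts \<times> verts"] by (simp add: digraph_def)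
    then have "finite E'" using E'(1) by (rule rev_finite_subset)
    moreover have "inj_on h ?I" by (auto simp: inj_on_def h_def e_def f_def split: if_splits)
    ultimately have "card ?I \<le> card E'" using card_inj_on_le by blast
    then show ?thesis by (simp add: power3_eq_cube mult.assoc)
  qed
  then show ?thesis using digraph_edges diam_edges by (simp add: hard_graph_def)
qed

end

section \<open>Choice of the parameters\<close>

text \<open>Both \<open>a\<close> and \<open>b\<close> are about D/3 and \<open>g\<close> about
  2D/3, with rounding by the residue of \<open>D\<close> modulo 3. The last inequality is an
  equality when 3 divides \<open>D\<close>.\<close>

lemma net_parameters:
  fixes D :: nat
  assumes "4 \<le> D"
  obtains a b g where "D = a + 1 + g" "1 \<le> b" "b \<le> a" "a \<le> b + 1" "a + b \<le> g + 1" "2 * b \<le> g"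
    "5 * (a + 1 + g) \<le> 3 * (2 * a + b + 1 + g) + 3"
proof -
  define a where "a = (D + 1) div 3"
  consider "D = 3 * a + 1" "1 \<le> a" | "D + 1 = 3 * a" "2 \<le> a" | "D = 3 * a" "2 \<le> a"
    unfolding a_def using assms by linarith
  then show thesis
  proof cases
    case 1
    then show thesis by (intro that[of a "2 * a" a]) auto
  next
    case 2
    then show thesis by (intro that[of a "2 * a - 2" "a - 1"]) auto
  next
    case 3
    then show thesis by (intro that[of a "2 * a - 1" "a - 1"]) auto
  qed
qed

text \<open>With q = 2^h the graph size is of order D * 4^h, so fields of characteristic two suffice
  to match \<open>n\<close> up to a constant factor.\<close>

lemma quarter_power_ex:
  fixes n D :: nat
  assumes "1 \<le> D" "D \<le> n"
  obtains h where "D * 4 ^ h \<le> n" "n < 4 * (D * 4 ^ h)"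
proof -
  have "\<exists>h. D * 4 ^ h \<le> n \<and> \<not> D * 4 ^ Suc h \<le> n"
  proof (rule ccontr)
    assume "\<not> ?thesis"
    then have step: "D * 4 ^ h \<le> n \<Longrightarrow> D * 4 ^ Suc h \<le> n" for h by blast
    have "D * 4 ^ h \<le> n" for h
    proof (induction h)
      case 0
      then show ?case using assms(2) by simp
    qed (rule step)
    from this[of n] have "D * 4 ^ n \<le> n" .
    moreover have "1 * 4 ^ n \<le> D * 4 ^ n" using assms(1) by (rule mult_le_mono1)
    moreover have "n < 4 ^ n" by (induction n) auto
    ultimately show False by linarith
  qed
  then show thesis using that by auto
qed

lemma hard_graph_small_diameter_ex:
  fixes n D :: nat
  assumes n: "100 \<le> n" and D: "2 \<le> D" "D \<le> 3"
  shows "\<exists>(V :: nat set) E L. hard_graph V E D L \<and> n \<le> 4 * card V \<and> card V \<le> 3 * n \<and> n\<^sup>2 \<le> 12 * L"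
proof -
  define m where "m = n div D"
  have m: "2 \<le> m" "D * m \<le> n" "n \<le> 2 * (D * m)"
  proof -
    show "D * m \<le> n" by (simp add: m_def)
    have "D = 2 \<or> D = 3" using D by linarith
    then show "2 \<le> m" "n \<le> 2 * (D * m)" using n unfolding m_def by (elim disjE; simp)+
  qed
  obtain V :: "nat set" and E where VE: "hard_graph V E D (D * m ^ 2)" "card V = card ({..<D} \<times> {..<m})"
    using hard_graph_nat[OF hard_graph_cyc_edges[OF D m(1)]] by blast
  have "n\<^sup>2 \<le> (2 * (D * m))\<^sup>2" using m(3) by (rule power_mono) simp
  also have "\<dots> = 4 * D * (D * m\<^sup>2)" by (simp add: power2_eq_square)
  also have "\<dots> \<le> 12 * (D * m\<^sup>2)" using D(2) by (intro mult_right_mono) auto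
  finally show ?thesis using VE m by (intro exI[of _ V] exI[of _ E] exI[of _ "D * m ^ 2"]) simp
qed

lemma hard_graph_large_diameter_ex:
  fixes n D :: nat
  assumes D: "4 \<le> D" "D \<le> n"
  shows "\<exists>(V :: nat set) E q. hard_graph V E D (q ^ 3) \<and> n \<le> 4 * card V \<and> card V \<le> 3 * n \<and> n \<le> 4 * (D * q\<^sup>2)"
proof -
  obtain a b g where params: "D = a + 1 + g" "1 \<le> b" "b \<le> a" "a \<le> b + 1" "a + b \<le> g + 1" "2 * b \<le> g"
    "5 * (a + 1 + g) \<le> 3 * (2 * a + b + 1 + g) + 3" using net_parameters[OF D(1)] .
  obtain h where h: "D * 4 ^ h \<le> n" "n < 4 * (D * 4 ^ h)" using quarter_power_ex[of D n] D by auto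
  define q :: nat where "q = 2 ^ h"
  have q2: "q\<^sup>2 = 4 ^ h" by (simp add: q_def power2_eq_square flip: power_mult_distrib)
  obtain inc where "affine_net q inc" using affine_net_power_of_two[of h] by (auto simp: q_def)
  then interpret spanner_net q inc a b g
    using params by (simp add: spanner_net_def spanner_net_axioms_def q_def)
  have hard: "hard_graph verts edges D (q ^ 3)" using hard_graph_edges params(1,7) by simp
  then obtain V :: "nat set" and E where VE: "hard_graph V E D (q ^ 3)" "card V = card verts"
    using hard_graph_nat by blast
  have "card V \<le> 3 * (q\<^sup>2 * D)" "q\<^sup>2 * D \<le> card V"
    using card_verts_le card_verts_ge params(1) VE(2) by simp_all
  then have "n \<le> 4 * card V" "card V \<le> 3 * n" "n \<le> 4 * (D * q\<^sup>2)"
    using h by (simp_all add: q2 mult.commute)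
  with VE(1) show ?thesis by blast
qed

section \<open>Comparison of the edge counts with the required bound\<close>

lemma powr_bound_power6:
  assumes "1 \<le> n" "1 \<le> D"
  shows "(real n powr (4/3) * real D powr (1/3)) ^ 6 = real n ^ 8 * real D ^ 2"
proof -
  have "(real n powr (4/3)) ^ 6 = real n powr 8" using assms by (simp add: powr_power)
  moreover have "(real D powr (1/3)) ^ 6 = real D powr 2" using assms by (simp add: powr_power)
  ultimately show ?thesis using assms by (simp add: power_mult_distrib)
qed

text \<open>Sixth powers remove the fractional exponents. After multiplication by D^9 the hypothesis
  \<open>D ^ 11 \<le> n\<close> turns n^8 D^11 into n^9, and 4^9 = 8^6 produces the constant
  1/8.\<close>

lemma edge_bound_large:
  fixes n D q :: nat
  assumes "1 \<le> n" "1 \<le> D" "D ^ 11 \<le> n" "n \<le> 4 * (D * q\<^sup>2)"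
  shows "1/8 * real n powr (4/3) * real D powr (1/3) \<le> real (q ^ 3)"
proof -
  let ?x = "real n powr (4/3) * real D powr (1/3)"
  have "n ^ 8 * D ^ 2 * D ^ 9 = n ^ 8 * D ^ 11" by (simp flip: power_add add: mult.assoc)
  also have "\<dots> \<le> n ^ 9" using assms(3) mult_le_mono2[of "D ^ 11" n "n ^ 8"]
    by (simp add: eval_nat_numeral mult.commute)
  also have "\<dots> \<le> (4 * (D * q\<^sup>2)) ^ 9" using assms(4) by (rule power_mono) simp
  also have "\<dots> = (8 * q ^ 3) ^ 6 * D ^ 9" by (simp add: power_mult_distrib flip: power_mult)
  finally have "n ^ 8 * D ^ 2 \<le> (8 * q ^ 3) ^ 6" using assms(2) by simp
  then have "?x ^ 6 \<le> real (8 * q ^ 3) ^ 6"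
    unfolding powr_bound_power6[OF assms(1,2)] of_nat_power[symmetric] of_nat_mult[symmetric] of_nat_le_iff .
  then have "?x \<le> real (8 * q ^ 3)" by (subst (asm) power_mono_iff) simp_all
  then show ?thesis by simp
qed

lemma edge_bound_small:
  fixes n D L :: nat
  assumes "100 \<le> n" "1 \<le> D" "D \<le> 3" "n\<^sup>2 \<le> 12 * L"
  shows "1/8 * real n powr (4/3) * real D powr (1/3) \<le> real L"
proof -
  let ?x = "real n powr (4/3) * real D powr (1/3)"
  have n: "1 \<le> n" using assms(1) by simp
  have "D ^ 2 \<le> 3 ^ 2" using assms(3) by (rule power_mono) simp
  then have "n ^ 8 * D ^ 2 * 12 ^ 6 \<le> n ^ 8 * (3 ^ 2 * 12 ^ 6)" by simp
  \<comment> \<open>The numerical constants are absorbed by 100^4, which the next step bounds by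
    n^4.\<close>
  also have "\<dots> \<le> n ^ 8 * (8 ^ 6 * 100 ^ 4)" by (intro mult_left_mono) auto
  also have "\<dots> \<le> n ^ 8 * (8 ^ 6 * n ^ 4)" using assms(1) by (intro mult_left_mono power_mono) auto
  also have "\<dots> = 8 ^ 6 * (n\<^sup>2) ^ 6" by (simp flip: power_mult power_add)
  also have "\<dots> \<le> 8 ^ 6 * (12 * L) ^ 6" using assms(4) by (intro mult_left_mono power_mono) auto
  also have "\<dots> = (8 * L) ^ 6 * 12 ^ 6" by (simp add: power_mult_distrib)
  finally have "n ^ 8 * D ^ 2 \<le> (8 * L) ^ 6" by (subst (asm) mult_le_cancel2) simp
  then have "?x ^ 6 \<le> real (8 * L) ^ 6"
    unfolding powr_bound_power6[OF n assms(2)] of_nat_power[symmetric] of_nat_mult[symmetric] of_nat_le_iff .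
  then have "?x \<le> real (8 * L)" by (subst (asm) power_mono_iff) simp_all
  then show ?thesis by simp
qed

lemma hard_graph_ex:
  fixes n D :: nat
  assumes n: "100 \<le> n" and D: "1 \<le> D" "real D \<le> real n powr (1/11)"
  shows "\<exists>(V :: nat set) E L. hard_graph V E D L \<and> n \<le> 4 * card V \<and> card V \<le> 3 * n \<and>
    1/8 * real n powr (4/3) * real D powr (1/3) \<le> real L"
proof -
  have "real D ^ 11 \<le> (real n powr (1/11)) ^ 11" using D(2) by (rule power_mono) simp
  also have "\<dots> = real n" using n by (simp add: powr_power)
  finally have D11: "D ^ 11 \<le> n" by (metis of_nat_le_iff of_nat_power)
  moreover have "D \<le> D ^ 11" using D(1) by (simp add: self_le_power)
  ultimately have "D \<le> n" by simp
  consider "D = 1" | "2 \<le> D" "D \<le> 3" | "4 \<le> D" using D(1) by linarith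
  then show ?thesis
  proof cases
    case 1
    \<comment> \<open>The complete graph admits any \<open>L\<close>, so the required bound itself
      is rounded up.\<close>
    define L where "L = nat \<lceil>1/8 * real n powr (4/3) * real D powr (1/3)\<rceil>"
    have "1/8 * real n powr (4/3) * real D powr (1/3) \<le> real L" unfolding L_def by linarith
    then show ?thesis using hard_graph_complete[of n L] n 1
      by (intro exI[of _ "{..<n}"] exI[of _ "{(u, v). u < n \<and> v < n \<and> u \<noteq> v}"] exI[of _ L]) simp
  next
    case 2
    then show ?thesis
      using hard_graph_small_diameter_ex[OF n 2] edge_bound_small[OF n D(1) 2(2)] by blast
  next
    case 3
    then show ?thesis
      using hard_graph_large_diameter_ex[OF 3 \<open>D \<le> n\<close>] edge_bound_large[OF _ D(1) D11] n
      by fastforce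
  qed
qed

theorem theorem1p2:
  shows "\<exists>c1 c2 c3 :: real. c1 > 0 \<and> c2 > 0 \<and> c3 > 0 \<and>
    (\<exists>n0 :: nat. \<forall>n \<ge> n0. \<forall>D :: nat. 1 \<le> D \<and> real D \<le> real n powr (1/11) \<longrightarrow>
      (\<exists>(V :: nat set) E. digraph V E \<and>
         c1 * real n \<le> real (card V) \<and> real (card V) \<le> c2 * real n \<and>
         diam_G V E = enat D \<and>
         (\<forall>E' \<subseteq> E. \<forall>k :: nat. diam_G V E' = enat k \<and> real k < 5/3 * real D - 1 \<longrightarrow>
             c3 * real n powr (4/3) * real D powr (1/3) \<le> real (card E'))))"
proof -
  have main: "\<exists>(V :: nat set) E. digraph V E \<and>
      1/4 * real n \<le> real (card V) \<and> real (card V) \<le> 3 * real n \<and> diam_G V E = enat D \<and>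
      (\<forall>E' \<subseteq> E. \<forall>k :: nat. diam_G V E' = enat k \<and> real k < 5/3 * real D - 1 \<longrightarrow>
        1/8 * real n powr (4/3) * real D powr (1/3) \<le> real (card E'))"
    if nD: "100 \<le> n" "1 \<le> D \<and> real D \<le> real n powr (1/11)" for n D :: nat
  proof -
    obtain V :: "nat set" and E L where *: "hard_graph V E D L" "n \<le> 4 * card V" "card V \<le> 3 * n"
      "1/8 * real n powr (4/3) * real D powr (1/3) \<le> real L"
      using hard_graph_ex[of n D] nD by blast
    have "1/8 * real n powr (4/3) * real D powr (1/3) \<le> real (card E')"
      if "E' \<subseteq> E" "diam_G V E' = enat k \<and> real k < 5/3 * real D - 1" for E' k
    proof -
      have "real (3 * k + 3) < real (5 * D)" using that(2) by simp
      then have "3 * k + 3 < 5 * D" by (simp only: of_nat_less_iff)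
      then have "L \<le> card E'" using *(1) that by (auto simp: hard_graph_def)
      then have "real L \<le> real (card E')" by simp
      with *(4) show ?thesis by (rule order.trans)
    qed
    with * show ?thesis
      by (intro exI[of _ V] exI[of _ E]) (auto simp: hard_graph_def)
  qed
  show ?thesis
    by (intro exI[of _ "1/4"] exI[of _ "3"] exI[of _ "1/8"] exI[of _ "100"] conjI allI impI main) simp_all
qed

end
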